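(* Let $a_0>0$ and let $J$ be the full-line Jacobi matrix with $b_n=0$ for all $n\in\mathbb Z$, $a_n=1$ for all $n\in\mathbb Z\setminus\{0\}$, and coefficient $a_0$ at $n=0$. For $n\ge1$ let $J^{(n)}$ be the $2n\times 2n$ truncation of $J$ to the sites $\{-n+1,\dots,n\}$, and label its eigenvalues around $\xi=0$ by $$\dots<\xi_{-1}^{(n)}<\xi_0^{(n)}<0\le\xi_1^{(n)}<\xi_2^{(n)}<\dots .$$ Then for every $j\in\mathbb Z$, $$\lim_{\substack{n\to\infty\\ n-j\text{ odd}}}n\left(\xi_{j+1}^{(n)}-\xi_j^{(n)}\right)=4\arctan a_0,\qquad \lim_{\substack{n\to\infty\\ n-j\text{ even}}}n\left(\xi_{j+1}^{(n)}-\xi_j^{(n)}\right)=2\pi-4\arctan a_0 .$$ In particular, if $a_0\ne1$, there is no clock spacing at $\xi=0$, i.e. it is not true that $\dfrac{\xi_{j+1}^{(n)}-\xi_j^{(n)}}{\xi_1^{(n)}-\xi_0^{(n)}}\to1$ as $n\to\infty$ for every $j\in\mathbb Z$.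
   Context: The Jacobi matrix with coefficients $a_n>0$, $b_n\in\mathbb R$ acts by $(Ju)_n=a_{n-1}u_{n-1}+b_nu_n+a_nu_{n+1}$. The truncation $J^{(n)}$ to the sites $\{-n+1,\dots,n\}$ is the $2n\times2n$ symmetric tridiagonal matrix with diagonal entries $b_{-n+1},\dots,b_n$ (here all $0$) and off-diagonal entries $a_{-n+1},\dots,a_{n-1}$ (here all $1$ except for the middle entry $a_0$). Its eigenvalues are simple. The limit statements for fixed $j$ include the assertion that the labelled eigenvalues $\xi_j^{(n)},\xi_{j+1}^{(n)}$ exist for all sufficiently large $n$. *)

theory Defs
  imports Complex_Main "Jordan_Normal_Form.Char_Poly"
begin

definition jacobi_matrix :: "(int \<Rightarrow> real) \<Rightarrow> (int \<Rightarrow> real) \<Rightarrow> int \<Rightarrow> int \<Rightarrow> real" where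
  "jacobi_matrix a b m k =
     (if k = m then b m else if k = m + 1 then a m else if k = m - 1 then a (m - 1) else 0)"

lemma jacobi_matrix_action:
  "(\<Sum>k\<in>{m-1..m+1}. jacobi_matrix a b m k * u k)
     = a (m - 1) * u (m - 1) + b m * u m + a m * u (m + 1)"
proof -
  have "{m-1..m+1} = {m - 1, m, m + 1}" by auto
  then show ?thesis by (simp add: jacobi_matrix_def)
qed

text \<open>Truncation to the sites \<open>{-n+1, \<dots>, n}\<close>; row and column \<open>i \<in> {0..<2 * n}\<close> belong to
  the site \<open>i - n + 1\<close>.\<close>

definition truncation :: "(int \<Rightarrow> int \<Rightarrow> real) \<Rightarrow> nat \<Rightarrow> real mat" where
  "truncation J n = mat (2 * n) (2 * n) (\<lambda>(i, k). J (int i - int n + 1) (int k - int n + 1))"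

definition J_model :: "real \<Rightarrow> int \<Rightarrow> int \<Rightarrow> real" where
  "J_model a0 = jacobi_matrix (\<lambda>n. if n = 0 then a0 else 1) (\<lambda>n. 0)"

text \<open>The labelling \<open>\<dots> < \<xi>\<^sub>-\<^sub>1 < \<xi>\<^sub>0 < 0 \<le> \<xi>\<^sub>1 < \<xi>\<^sub>2 < \<dots>\<close> of a finite set \<open>E\<close> around 0. Only the
  labels in \<open>label_range E\<close> are in use; outside this range the value of \<open>label E\<close> has no
  meaning.\<close>

definition label_range :: "real set \<Rightarrow> int set" where
  "label_range E = {1 - int (card {x\<in>E. x < 0}) .. int (card {x\<in>E. 0 \<le> x})}"

definition label :: "real set \<Rightarrow> int \<Rightarrow> real" where
  "label E j = sorted_list_of_set E ! nat (j - 1 + int (card {x\<in>E. x < 0}))"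

lemma label_spec:
  assumes "finite E"
  shows "strict_mono_on (label_range E) (label E)"
    and "label E ` label_range E = E"
    and "\<And>j. j \<in> label_range E \<Longrightarrow> label E j < 0 \<longleftrightarrow> j \<le> 0"
proof -
  define m where "m = card {x\<in>E. x < 0}"
  define p where "p = card {x\<in>E. 0 \<le> x}"
  define xs where "xs = sorted_list_of_set E"
  have E: "E = {x\<in>E. x < 0} \<union> {x\<in>E. 0 \<le> x}" by auto
  have len: "length xs = m + p"
    unfolding xs_def m_def p_def length_sorted_list_of_set
    by (subst E, rule card_Un_disjoint) (use assms in auto)
  have R: "label_range E = {1 - int m .. int p}"
    by (simp add: label_range_def m_def p_def)
  have L: "label E j = xs ! nat (j - 1 + int m)" for j
    by (simp add: label_def m_def xs_def)
  have set_xs: "set xs = E" using assms by (simp add: xs_def)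
  have sw: "sorted_wrt (<) xs" by (simp add: xs_def)
  have less: "xs ! i < xs ! k" if "i < k" "k < m + p" for i k
    using sorted_wrt_nth_less[OF sw that(1)] that len by simp
  have less_iff: "xs ! i < xs ! k \<longleftrightarrow> i < k" if "i < m + p" "k < m + p" for i k
    using less that by (metis less_asym linorder_neqE_nat)
  have inj: "inj_on ((!) xs) {..<m + p}"
    by (rule inj_onI) (metis lessThan_iff less_iff nat_neq_iff order_less_irrefl)
  show "strict_mono_on (label_range E) (label E)"
    unfolding R L by (rule strict_mono_onI, rule less) auto
  have idx: "(\<lambda>j. nat (j - 1 + int m)) ` {1 - int m .. int p} = {..<m + p}"
  proof (intro subset_antisym subsetI)
    fix i assume "i \<in> {..<m + p}"
    then have "i = nat ((int i + 1 - int m) - 1 + int m)"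
      "int i + 1 - int m \<in> {1 - int m .. int p}" by auto
    then show "i \<in> (\<lambda>j. nat (j - 1 + int m)) ` {1 - int m .. int p}" by blast
  qed auto
  have "label E ` label_range E = (!) xs ` (\<lambda>j. nat (j - 1 + int m)) ` {1 - int m .. int p}"
    by (simp add: R L image_image)
  also have "\<dots> = set xs" unfolding idx by (auto simp: set_conv_nth len)
  finally show "label E ` label_range E = E" by (simp add: set_xs)
  define N where "N = {i. i < m + p \<and> xs ! i < 0}"
  have "(!) xs ` N = {x\<in>E. x < 0}"
    unfolding set_xs[symmetric] N_def by (auto simp: in_set_conv_nth len)
  moreover have "inj_on ((!) xs) N" by (rule inj_on_subset[OF inj]) (auto simp: N_def)
  ultimately have cN: "card N = m" by (metis card_image m_def)
  have neg_iff: "xs ! i < 0 \<longleftrightarrow> i < m" if i: "i < m + p" for i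
  proof
    assume neg: "xs ! i < 0"
    have "xs ! k < 0" if "k \<le> i" for k
      using less[of k i] neg i that by (cases "k = i") (auto intro: less_trans)
    then have "{..i} \<subseteq> N" using i by (auto simp: N_def)
    then have "card {..i} \<le> card N" by (rule card_mono[rotated]) (simp add: N_def)
    then show "i < m" using cN by simp
  next
    assume "i < m"
    show "xs ! i < 0"
    proof (rule ccontr)
      assume nn: "\<not> xs ! i < 0"
      have "N \<subseteq> {..<i}"
      proof
        fix k assume "k \<in> N"
        then have k: "k < m + p" "xs ! k < xs ! i" using nn by (auto simp: N_def)
        then show "k \<in> {..<i}" using less_iff[OF k(1) i] by simp
      qed
      then have "card N \<le> card {..<i}" by (rule card_mono[rotated]) simp
      then show False using cN \<open>i < m\<close> by simp
    qed
  qed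
  show "label E j < 0 \<longleftrightarrow> j \<le> 0" if "j \<in> label_range E" for j
  proof -
    from that have j: "1 - int m \<le> j" "j \<le> int p" by (auto simp: R)
    then have "nat (j - 1 + int m) < m + p" by linarith
    then have "label E j < 0 \<longleftrightarrow> nat (j - 1 + int m) < m" unfolding L by (rule neg_iff)
    also have "\<dots> \<longleftrightarrow> j \<le> 0" using j by linarith
    finally show ?thesis .
  qed
qed

definition eigvals :: "real \<Rightarrow> nat \<Rightarrow> real set" where
  "eigvals a0 n = {x. eigenvalue (truncation (J_model a0) n) x}"

lemma finite_eigvals: "finite (eigvals a0 n)"
proof -
  define A where "A = truncation (J_model a0) n"
  have A: "A \<in> carrier_mat (2 * n) (2 * n)" by (simp add: A_def truncation_def)
  have "char_poly A \<noteq> 0" using degree_monic_char_poly[OF A] by auto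
  then show ?thesis
    using poly_roots_finite by (simp add: eigvals_def A_def[symmetric] eigenvalue_root_char_poly[OF A])
qed

definition \<xi> :: "real \<Rightarrow> nat \<Rightarrow> int \<Rightarrow> real" where
  "\<xi> a0 n j = label (eigvals a0 n) j"

end

theory Submission
  imports Defs
begin

text \<open>
  Inside each half of the chain the coefficients are those of the free matrix, so an eigenvector
  for \<open>x = 2 cos \<theta>\<close> is there a multiple of \<open>sin (k \<theta>)\<close>, \<open>k\<close> being the distance to the site just
  outside the end. Matching the halves across the bond \<open>a0\<close> gives (lemma \<open>eigvals_iff_sin\<close>)
  \<open>sin ((n + 1) \<theta>) = c sin (n \<theta>)\<close> with \<open>c = a0\<close> or \<open>c = - a0\<close>, the even and the odd eigenvectors.

  Near \<open>x = 0\<close> put \<open>\<theta> = pi / 2 - \<phi>\<close>, so that \<open>x = 2 sin \<phi>\<close>. The equation for \<open>c\<close> then says that the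
  phase \<open>n \<phi> - arctan ((c - sin \<phi>) / cos \<phi>)\<close> is a multiple \<open>i pi / 2\<close> with \<open>n - i\<close> odd
  (\<open>sin_equation_iff_phase\<close>). On a fixed window around 0 both phases are strictly increasing for
  large \<open>n\<close>, because the arctangent there has a slope bounded independently of \<open>n\<close>; and the phase for
  \<open>- a0\<close> exceeds that for \<open>a0\<close> by an amount strictly between 0 and \<open>pi\<close>. Hence the solutions of the
  two equations alternate and none is missed between consecutive ones (\<open>angle_neighbours\<close>).

  At a solution with phase \<open>t\<close> one has \<open>n \<phi> = t + arctan ((c - sin \<phi>) / cos \<phi>)\<close>, which tends to
  \<open>t + arctan c\<close> (\<open>phase_root_limit\<close>). The limits show which solutions lie on either side of 0, and
  with the absence of gaps this fixes all labels (\<open>eventually_label_eq\<close>). So \<open>n \<xi>\<^sub>j\<close> is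
  asymptotically \<open>j pi - 2 arctan a0\<close> for odd \<open>n - j\<close> and \<open>(j - 1) pi + 2 arctan a0\<close> for even \<open>n - j\<close>;
  the spacings are the differences. The two limiting spacings agree only if \<open>arctan a0 = pi / 4\<close>.
\<close>

section \<open>Labels of neighbouring elements\<close>

lemma label_step:
  assumes "finite E" "x \<in> E" "y \<in> E" "x < y" and gap: "\<And>z. z \<in> E \<Longrightarrow> x < z \<Longrightarrow> z < y \<Longrightarrow> False"
  shows "\<exists>k. k \<in> label_range E \<and> k + 1 \<in> label_range E \<and> label E k = x \<and> label E (k + 1) = y"
proof -
  note sp = label_spec[OF assms(1)]
  obtain k where k: "k \<in> label_range E" "label E k = x" using sp(2) assms(2) by (metis imageE)
  obtain l where l: "l \<in> label_range E" "label E l = y" using sp(2) assms(3) by (metis imageE)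
  have mono: "label E i < label E m \<longleftrightarrow> i < m" if "i \<in> label_range E" "m \<in> label_range E" for i m
    using strict_mono_on_less[OF sp(1) that] .
  have "k < l" using mono[OF k(1) l(1)] k l assms(4) by simp
  moreover have "\<not> k + 1 < l"
  proof
    assume that: "k + 1 < l"
    have r: "k + 1 \<in> label_range E" using k(1) l(1) that by (auto simp: label_range_def)
    then have "label E (k + 1) \<in> E" using sp(2) by blast
    then show False using gap mono[OF k(1) r] mono[OF r l(1)] k l that by auto
  qed
  ultimately have "l = k + 1" by linarith
  then show ?thesis using k l by blast
qed

lemma label_inj:
  assumes "finite E" "k \<in> label_range E" "l \<in> label_range E" "label E k = label E l"
  shows "k = l"
  using strict_mono_on_imp_inj_on[OF label_spec(1)[OF assms(1)]] assms(2-4) by (auto dest: inj_onD)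

text \<open>Labels are counted from 0, so a list of neighbouring elements that is only known locally
  determines them as soon as the sign change is located.
  The statement is asymptotic for each fixed \<open>j\<close>, and the threshold may grow with \<open>j\<close>.\<close>

lemma eventually_label_eq:
  fixes E :: "nat \<Rightarrow> real set" and e :: "nat \<Rightarrow> int \<Rightarrow> real"
  assumes fin: "\<And>n. finite (E n)"
    and mem: "\<And>j. \<forall>\<^sub>F n in F. e n j \<in> E n"
    and less: "\<And>j. \<forall>\<^sub>F n in F. e n j < e n (j + 1)"
    and gap: "\<And>j. \<forall>\<^sub>F n in F. \<forall>x\<in>E n. \<not> (e n j < x \<and> x < e n (j + 1))"
    and neg: "\<forall>\<^sub>F n in F. e n 0 < 0" and pos: "\<forall>\<^sub>F n in F. 0 \<le> e n 1"
  shows "\<forall>\<^sub>F n in F. j \<in> label_range (E n) \<and> label (E n) j = e n j"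
proof -
  have step: "\<forall>\<^sub>F n in F. \<exists>k. k \<in> label_range (E n) \<and> k + 1 \<in> label_range (E n)
      \<and> label (E n) k = e n j \<and> label (E n) (k + 1) = e n (j + 1)" for j
    using mem[of j] mem[of "j + 1"] less[of j] gap[of j]
    by eventually_elim (rule label_step[OF fin], auto)
  show ?thesis
  proof (induction j rule: int_induct[where k = 0])
    case base
    show ?case using step[of 0] neg pos
    proof eventually_elim
      case (elim n)
      then obtain k where k: "k \<in> label_range (E n)" "k + 1 \<in> label_range (E n)"
        "label (E n) k = e n 0" "label (E n) (k + 1) = e n 1" by auto
      then have "k = 0"
        using label_spec(3)[OF fin k(1)] label_spec(3)[OF fin k(2)] elim by auto
      then show ?case using k by simp
    qed
  next
    case (step1 j)
    show ?case using step[of j] step1(2)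
      by eventually_elim (metis label_inj fin)
  next
    case (step2 j)
    show ?case using step[of "j - 1"] step2(2)
    proof eventually_elim
      case (elim n)
      then obtain k where k: "k \<in> label_range (E n)" "k + 1 \<in> label_range (E n)"
        "label (E n) k = e n (j - 1)" "label (E n) (k + 1) = e n j" by auto
      from elim(2) have "j \<in> label_range (E n)" "label (E n) (k + 1) = label (E n) j"
        using k(4) by simp_all
      then have "k + 1 = j" by (rule label_inj[OF fin k(2)])
      then have "k = j - 1" by simp
      then show ?case using k by simp
    qed
  qed
qed

section \<open>The eigenvalue equation\<close>

text \<open>Coupling between the rows \<open>i - 1\<close> and \<open>i\<close> of the truncation, which are the sites \<open>i - n\<close> and
  \<open>i - n + 1\<close>; the exceptional bond joins the sites 0 and 1.\<close>

definition bond :: "real \<Rightarrow> nat \<Rightarrow> nat \<Rightarrow> real" where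
  "bond a0 n i = (if i = n then a0 else 1)"

lemma truncation_row:
  assumes i: "i < 2 * n" and w: "w 0 = 0" "w (2 * n + 1) = 0"
  shows "(\<Sum>k<2 * n. truncation (J_model a0) n $$ (i, k) * w (Suc k))
    = bond a0 n i * w i + bond a0 n (Suc i) * w (Suc (Suc i))"
proof -
  have entry: "truncation (J_model a0) n $$ (i, k) * w (Suc k)
     = (if k = Suc i then bond a0 n (Suc i) * w (Suc (Suc i)) else 0)
     + (if k = i - 1 then (if i = 0 then 0 else bond a0 n i * w i) else 0)" if "k < 2 * n" for k
    using i that by (auto simp: truncation_def J_model_def jacobi_matrix_def bond_def)
  have "(\<Sum>k<2 * n. truncation (J_model a0) n $$ (i, k) * w (Suc k))
     = (\<Sum>k<2 * n. (if k = Suc i then bond a0 n (Suc i) * w (Suc (Suc i)) else 0))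
     + (\<Sum>k<2 * n. (if k = i - 1 then (if i = 0 then 0 else bond a0 n i * w i) else 0))"
    unfolding sum.distrib[symmetric] by (rule sum.cong) (use entry in auto)
  also have "\<dots> = bond a0 n i * w i + bond a0 n (Suc i) * w (Suc (Suc i))"
  proof -
    have "w (Suc (Suc i)) = 0" if "\<not> Suc i < 2 * n"
      using that i w(2) by (metis Suc_eq_plus1 Suc_lessI)
    then have "(\<Sum>k<2 * n. (if k = Suc i then bond a0 n (Suc i) * w (Suc (Suc i)) else 0))
        = bond a0 n (Suc i) * w (Suc (Suc i))" by (cases "Suc i < 2 * n") auto
    moreover have "(\<Sum>k<2 * n. (if k = i - 1 then (if i = 0 then 0 else bond a0 n i * w i) else 0))
        = bond a0 n i * w i" using i w(1) by (cases "i = 0") auto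
    ultimately show ?thesis by simp
  qed
  finally show ?thesis .
qed

text \<open>An eigenvector is shifted by one place and padded by a 0 at either end. The first and the
  last row then have the same three-term form as the others, whatever the bond to the padding is.\<close>

lemma eigvals_iff_recurrence:
  "x \<in> eigvals a0 n \<longleftrightarrow>
    (\<exists>w. w 0 = 0 \<and> w (2 * n + 1) = 0 \<and> (\<exists>i<2 * n. w (Suc i) \<noteq> 0) \<and>
      (\<forall>i<2 * n. bond a0 n i * w i + bond a0 n (Suc i) * w (Suc (Suc i)) = x * w (Suc i)))"
  (is "_ \<longleftrightarrow> (\<exists>w. ?P w)")
proof -
  let ?A = "truncation (J_model a0) n"
  have A: "?A \<in> carrier_mat (2 * n) (2 * n)" by (simp add: truncation_def)
  have row: "(?A *\<^sub>v v) $ i = (\<Sum>k<2 * n. ?A $$ (i, k) * v $ k)"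
    if "v \<in> carrier_vec (2 * n)" "i < 2 * n" for v i
    using that A by (auto simp: scalar_prod_def lessThan_atLeast0 intro!: sum.cong)
  show ?thesis
  proof
    assume "x \<in> eigvals a0 n"
    then obtain v where v: "v \<in> carrier_vec (2 * n)" "v \<noteq> 0\<^sub>v (2 * n)" "?A *\<^sub>v v = x \<cdot>\<^sub>v v"
      using A by (auto simp: eigvals_def eigenvalue_def eigenvector_def)
    define w where "w k = (if k = 0 \<or> k = 2 * n + 1 then 0 else v $ (k - 1))" for k
    have ws: "w (Suc k) = v $ k" if "k < 2 * n" for k using that by (simp add: w_def)
    have w0: "w 0 = 0" "w (2 * n + 1) = 0" by (auto simp: w_def)
    have "\<exists>i<2 * n. w (Suc i) \<noteq> 0"
    proof (rule ccontr)
      assume "\<not> ?thesis"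
      then have "v = 0\<^sub>v (2 * n)" using v(1) ws by (intro eq_vecI) auto
      then show False using v(2) by simp
    qed
    moreover have "bond a0 n i * w i + bond a0 n (Suc i) * w (Suc (Suc i)) = x * w (Suc i)"
      if i: "i < 2 * n" for i
    proof -
      have "(\<Sum>k<2 * n. ?A $$ (i, k) * w (Suc k)) = (?A *\<^sub>v v) $ i"
        unfolding row[OF v(1) i] by (rule sum.cong) (auto simp: ws)
      also have "\<dots> = x * w (Suc i)" using v(1,3) i by (simp add: ws)
      finally show ?thesis using truncation_row[OF i w0] by simp
    qed
    ultimately show "\<exists>w. ?P w" using w0 by blast
  next
    assume "\<exists>w. ?P w"
    then obtain w where w: "?P w" ..
    define v where "v = vec (2 * n) (\<lambda>k. w (Suc k))"
    have v: "v \<in> carrier_vec (2 * n)" by (simp add: v_def)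
    have "?A *\<^sub>v v = x \<cdot>\<^sub>v v"
    proof (rule eq_vecI)
      fix i assume "i < dim_vec (x \<cdot>\<^sub>v v)"
      then have i: "i < 2 * n" using v by simp
      have "(?A *\<^sub>v v) $ i = (\<Sum>k<2 * n. ?A $$ (i, k) * w (Suc k))"
        unfolding row[OF v i] by (rule sum.cong) (auto simp: v_def)
      then show "(?A *\<^sub>v v) $ i = (x \<cdot>\<^sub>v v) $ i"
        using truncation_row[OF i, of w a0] w i v by (simp add: v_def)
    qed (use v A in auto)
    moreover have "v \<noteq> 0\<^sub>v (2 * n)"
    proof
      assume "v = 0\<^sub>v (2 * n)"
      then have "v $ i = 0" if "i < 2 * n" for i using that by simp
      then show False using w by (auto simp: v_def)
    qed
    ultimately show "x \<in> eigvals a0 n"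
      using v A by (auto simp: eigvals_def eigenvalue_def eigenvector_def)
  qed
qed

lemma sin_Suc_Suc:
  "sin (real (Suc (Suc i)) * \<theta>) = 2 * cos \<theta> * sin (real (Suc i) * \<theta>) - sin (real i * \<theta>)"
proof -
  have "sin (real (Suc (Suc i)) * \<theta>) = sin (real (Suc i) * \<theta> + \<theta>)"
    "sin (real i * \<theta>) = sin (real (Suc i) * \<theta> - \<theta>)" by (auto simp: algebra_simps)
  then show ?thesis by (simp only: sin_add sin_diff) (simp add: algebra_simps)
qed

text \<open>Stated without dividing by \<open>sin \<theta>\<close>: the solution with \<open>w 0 = 0\<close> and given \<open>w 1\<close> is unique, and
  the sines satisfy the same recurrence by the addition theorem.\<close>

lemma free_recurrence_sin:
  assumes w0: "w 0 = 0" and rec: "\<And>i. Suc i < m \<Longrightarrow> w i + w (Suc (Suc i)) = 2 * cos \<theta> * w (Suc i)"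
  shows "i \<le> m \<Longrightarrow> sin \<theta> * w i = w 1 * sin (real i * \<theta>)"
proof (induction i rule: less_induct)
  case (less i)
  consider "i = 0" | "i = 1" | k where "i = Suc (Suc k)"
    by (metis One_nat_def not0_implies_Suc)
  then show ?case
  proof cases
    case (3 k)
    have wi: "w i = 2 * cos \<theta> * w (Suc k) - w k"
      using rec[of k] 3 less.prems by simp
    have "sin \<theta> * w i = 2 * cos \<theta> * (sin \<theta> * w (Suc k)) - sin \<theta> * w k"
      unfolding wi by (simp add: algebra_simps)
    also have "\<dots> = 2 * cos \<theta> * (w 1 * sin (real (Suc k) * \<theta>)) - w 1 * sin (real k * \<theta>)"
      using less.IH[of k] less.IH[of "Suc k"] less.prems 3 by simp
    also have "\<dots> = w 1 * sin (real i * \<theta>)"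
      unfolding 3 sin_Suc_Suc by (simp add: algebra_simps del: of_nat_Suc)
    finally show ?thesis .
  qed (use w0 in auto)
qed

text \<open>With \<open>\<alpha>\<close> and \<open>\<beta>\<close> the amplitudes at the two ends, the two middle rows say that
  \<open>(\<alpha>, \<beta>)\<close> is an eigenvector, with eigenvalue \<open>sin ((n + 1) \<theta>)\<close>, of the symmetric two by two matrix
  with zero diagonal and off-diagonal entry \<open>a0 sin (n \<theta>)\<close>; and the eigenvalues of that matrix are
  \<open>a0 sin (n \<theta>)\<close> and \<open>- a0 sin (n \<theta>)\<close>.\<close>

lemma eigvals_iff_sin:
  assumes n: "n \<ge> 1" and s: "sin \<theta> \<noteq> 0"
  shows "2 * cos \<theta> \<in> eigvals a0 n \<longleftrightarrow>
    (\<exists>c\<in>{a0, - a0}. sin (real (Suc n) * \<theta>) = c * sin (real n * \<theta>))"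
proof
  let ?S = "\<lambda>i. sin (real i * \<theta>)"
  assume "2 * cos \<theta> \<in> eigvals a0 n"
  then obtain w where w: "w 0 = 0" "w (2 * n + 1) = 0" "\<exists>i<2 * n. w (Suc i) \<noteq> 0"
    and rec: "\<And>i. i < 2 * n \<Longrightarrow>
      bond a0 n i * w i + bond a0 n (Suc i) * w (Suc (Suc i)) = 2 * cos \<theta> * w (Suc i)"
    unfolding eigvals_iff_recurrence by blast
  \<comment> \<open>The same sequence read from the right-hand end.\<close>
  define u where "u k = w (2 * n + 1 - k)" for k
  define \<alpha> where "\<alpha> = w 1"
  define \<beta> where "\<beta> = u 1"
  have left: "sin \<theta> * w i = \<alpha> * ?S i" if "i \<le> n" for i
    unfolding \<alpha>_def
  proof (rule free_recurrence_sin[where w = w and m = n, OF w(1) _ that])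
    show "w i + w (Suc (Suc i)) = 2 * cos \<theta> * w (Suc i)" if "Suc i < n" for i
      using rec[of i] that by (simp add: bond_def)
  qed
  have right: "sin \<theta> * u i = \<beta> * ?S i" if "i \<le> n" for i
    unfolding \<beta>_def
  proof (rule free_recurrence_sin[where w = u and m = n, OF _ _ that])
    show "u i + u (Suc (Suc i)) = 2 * cos \<theta> * u (Suc i)" if i: "Suc i < n" for i
    proof -
      define k where "k = 2 * n - 1 - i"
      have k: "k < 2 * n" "k > n" "2 * n + 1 - i = Suc (Suc k)" "2 * n + 1 - Suc i = Suc k"
        "2 * n + 1 - Suc (Suc i) = k" using i by (auto simp: k_def)
      show ?thesis using rec[OF k(1)] k(2) unfolding u_def k(3-5) by (simp add: bond_def)
    qed
  qed (use w(2) in \<open>simp add: u_def\<close>)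
  obtain m where m: "n = Suc m" using n by (cases n) auto
  have mid1: "w m + a0 * u n = 2 * cos \<theta> * w n"
    using rec[of m] m by (simp add: bond_def u_def)
  have mid2: "u m + a0 * w n = 2 * cos \<theta> * u n"
  proof -
    have "2 * n + 1 - n = Suc n" "2 * n + 1 - m = Suc (Suc n)" using m by auto
    then have "u n = w (Suc n)" "u m = w (Suc (Suc n))" by (simp_all only: u_def)
    then show ?thesis using rec[of n] n by (simp add: bond_def)
  qed
  have S: "?S (Suc n) = 2 * cos \<theta> * ?S n - ?S m" unfolding m by (rule sin_Suc_Suc)
  have e1: "\<alpha> * ?S (Suc n) = a0 * \<beta> * ?S n"
  proof -
    have "\<alpha> * ?S (Suc n) = 2 * cos \<theta> * (\<alpha> * ?S n) - \<alpha> * ?S m"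
      unfolding S by (simp add: algebra_simps)
    also have "\<dots> = sin \<theta> * (2 * cos \<theta> * w n - w m)"
      using left[of n] left[of m] m by (simp add: algebra_simps)
    also have "\<dots> = a0 * (sin \<theta> * u n)" by (simp flip: mid1)
    also have "\<dots> = a0 * \<beta> * ?S n" using right[of n] by simp
    finally show ?thesis .
  qed
  have e2: "\<beta> * ?S (Suc n) = a0 * \<alpha> * ?S n"
  proof -
    have "\<beta> * ?S (Suc n) = 2 * cos \<theta> * (\<beta> * ?S n) - \<beta> * ?S m"
      unfolding S by (simp add: algebra_simps)
    also have "\<dots> = sin \<theta> * (2 * cos \<theta> * u n - u m)"
      using right[of n] right[of m] m by (simp add: algebra_simps)
    also have "\<dots> = a0 * (sin \<theta> * w n)" by (simp flip: mid2)
    also have "\<dots> = a0 * \<alpha> * ?S n" using left[of n] by simp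
    finally show ?thesis .
  qed
  have "\<alpha> \<noteq> 0 \<or> \<beta> \<noteq> 0"
  proof (rule ccontr)
    assume "\<not> ?thesis"
    then have z: "w i = 0" "u i = 0" if "i \<le> n" for i
      using left[OF that] right[OF that] s by auto
    have "w i = 0" if "i \<le> 2 * n" for i
    proof (cases "i \<le> n")
      case False
      then have "u (2 * n + 1 - i) = 0" by (intro z) simp
      then show ?thesis using that by (simp add: u_def)
    qed (rule z)
    then show False using w(3) by auto
  qed
  moreover have square: "p * P\<^sup>2 = p * (a0 * Q)\<^sup>2"
    if "p * P = a0 * q * Q" "q * P = a0 * p * Q" for p q P Q :: real
  proof -
    have "p * P\<^sup>2 = (p * P) * P" by (simp add: power2_eq_square)
    also have "\<dots> = a0 * Q * (q * P)" unfolding that(1) by simp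
    also have "\<dots> = p * (a0 * Q)\<^sup>2" unfolding that(2) by (simp add: power2_eq_square)
    finally show ?thesis .
  qed
  ultimately have "(?S (Suc n))\<^sup>2 = (a0 * ?S n)\<^sup>2"
    using square[OF e1 e2] square[OF e2 e1] by (metis mult_cancel_left)
  then have "?S (Suc n) = a0 * ?S n \<or> ?S (Suc n) = - (a0 * ?S n)" by (simp only: power2_eq_iff)
  then show "\<exists>c\<in>{a0, - a0}. ?S (Suc n) = c * ?S n" by (metis insertCI mult_minus_left)
next
  let ?S = "\<lambda>i. sin (real i * \<theta>)"
  assume "\<exists>c\<in>{a0, - a0}. ?S (Suc n) = c * ?S n"
  then have "?S (Suc n) = 1 * a0 * ?S n \<or> ?S (Suc n) = (- 1) * a0 * ?S n" by auto
  then obtain \<sigma> :: real where \<sigma>: "\<sigma> * \<sigma> = 1" and eq: "?S (Suc n) = \<sigma> * a0 * ?S n"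
  proof
    assume "?S (Suc n) = 1 * a0 * ?S n"
    then show ?thesis by (intro that[of 1]) simp_all
  next
    assume "?S (Suc n) = (- 1) * a0 * ?S n"
    then show ?thesis by (intro that[of "- 1"]) simp_all
  qed
  \<comment> \<open>\<open>\<sigma>\<close> is the parity of the eigenvector under reflection of the chain.\<close>
  define w where "w i = (if i \<le> n then \<sigma> * ?S i else ?S (2 * n + 1 - i))" for i
  obtain m where m: "n = Suc m" using n by (cases n) auto
  have "bond a0 n i * w i + bond a0 n (Suc i) * w (Suc (Suc i)) = 2 * cos \<theta> * w (Suc i)"
    if i: "i < 2 * n" for i
  proof -
    have mid: "?S (Suc n) = 2 * cos \<theta> * ?S n - ?S m" unfolding m by (rule sin_Suc_Suc)
    consider "Suc i < n" | "Suc i = n" | "i = n" | "i > n" by linarith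
    then show ?thesis
    proof cases
      case 1
      then have "w i = \<sigma> * ?S i" "w (Suc i) = \<sigma> * ?S (Suc i)"
        "w (Suc (Suc i)) = \<sigma> * ?S (Suc (Suc i))" by (simp_all add: w_def)
      then show ?thesis using 1
        by (simp only: bond_def sin_Suc_Suc) (simp add: algebra_simps del: of_nat_Suc)
    next
      case 2
      have "2 * n + 1 - Suc (Suc i) = n" using 2 by simp
      then have "w i = \<sigma> * ?S m" "w (Suc i) = \<sigma> * ?S n" "w (Suc (Suc i)) = ?S n"
        using 2 m by (simp_all add: w_def)
      moreover have "\<sigma> * (2 * cos \<theta> * ?S n - ?S m) = a0 * ?S n"
        unfolding mid[symmetric] eq using \<sigma> by (simp flip: mult.assoc)
      ultimately show ?thesis using 2 by (simp add: bond_def algebra_simps)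
    next
      case 3
      have "2 * n + 1 - Suc i = n" "2 * n + 1 - Suc (Suc i) = m" using 3 m by auto
      then have "w i = \<sigma> * ?S n" "w (Suc i) = ?S n" "w (Suc (Suc i)) = ?S m"
        using 3 by (simp_all add: w_def)
      moreover have "2 * cos \<theta> * ?S n - ?S m = \<sigma> * a0 * ?S n" using mid eq by simp
      ultimately show ?thesis using 3 by (simp add: bond_def algebra_simps)
    next
      case 4
      define k where "k = 2 * n - 1 - i"
      have "2 * n + 1 - i = Suc (Suc k)" "2 * n + 1 - Suc i = Suc k"
        "2 * n + 1 - Suc (Suc i) = k" using i by (auto simp: k_def)
      then have "w i = ?S (Suc (Suc k))" "w (Suc i) = ?S (Suc k)" "w (Suc (Suc i)) = ?S k"
        using 4 by (simp_all add: w_def del: of_nat_Suc)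
      then show ?thesis using 4 by (simp only: bond_def sin_Suc_Suc) simp
    qed
  qed
  moreover have "w 0 = 0" "w (2 * n + 1) = 0" by (auto simp: w_def)
  moreover have "w (Suc (2 * n - 1)) \<noteq> 0"
  proof -
    have "\<not> Suc (2 * n - 1) \<le> n" "2 * n + 1 - Suc (2 * n - 1) = 1" using n by auto
    then show ?thesis using s by (simp add: w_def)
  qed
  moreover have "2 * n - 1 < 2 * n" using n by simp
  ultimately show "2 * cos \<theta> \<in> eigvals a0 n" unfolding eigvals_iff_recurrence by blast
qed

section \<open>The phase\<close>

definition phase_shift :: "real \<Rightarrow> real \<Rightarrow> real" where
  "phase_shift c \<phi> = arctan ((c - sin \<phi>) / cos \<phi>)"

definition phase :: "real \<Rightarrow> nat \<Rightarrow> real \<Rightarrow> real" where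
  "phase c n \<phi> = real n * \<phi> - phase_shift c \<phi>"

text \<open>Divide \<open>sin y sin \<phi> + cos y cos \<phi> = c sin y\<close>, where \<open>y = n (pi / 2 - \<phi>)\<close>, by \<open>cos \<phi>\<close> and
  write the quotient \<open>(c - sin \<phi>) / cos \<phi>\<close> as \<open>tan h\<close>: the equation becomes \<open>cos (y + h) = 0\<close>.\<close>

lemma sin_equation_iff_phase:
  assumes "cos \<phi> > 0"
  shows "sin (real (Suc n) * (pi / 2 - \<phi>)) = c * sin (real n * (pi / 2 - \<phi>)) \<longleftrightarrow>
    (\<exists>i. odd (int n - i) \<and> phase c n \<phi> = of_int i * (pi / 2))"
proof -
  define y where "y = real n * (pi / 2 - \<phi>)"
  define h where "h = phase_shift c \<phi>"
  have ch: "cos h \<noteq> 0" by (simp add: h_def phase_shift_def)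
  have "tan h = (c - sin \<phi>) / cos \<phi>" by (simp add: h_def phase_shift_def tan_arctan)
  then have sh: "cos \<phi> * sin h = (c - sin \<phi>) * cos h"
    using assms ch by (simp add: tan_def field_simps)
  have "real (Suc n) * (pi / 2 - \<phi>) = y + (pi / 2 - \<phi>)" by (simp add: y_def algebra_simps)
  then have "sin (real (Suc n) * (pi / 2 - \<phi>)) = sin y * sin \<phi> + cos y * cos \<phi>"
    by (simp only: sin_add) (simp add: cos_diff sin_diff)
  then have "cos h * (sin (real (Suc n) * (pi / 2 - \<phi>)) - c * sin y)
      = cos h * (sin y * sin \<phi> + cos y * cos \<phi> - c * sin y)" by simp
  also have "\<dots> = cos \<phi> * (cos y * cos h - sin y * sin h)" proof -
    have "cos \<phi> * (cos y * cos h - sin y * sin h)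
        = cos \<phi> * cos y * cos h - sin y * (cos \<phi> * sin h)" by (simp add: algebra_simps)
    then show ?thesis unfolding sh by (simp add: algebra_simps)
  qed
  also have "\<dots> = cos \<phi> * cos (y + h)" by (simp only: cos_add)
  finally have "sin (real (Suc n) * (pi / 2 - \<phi>)) = c * sin y \<longleftrightarrow> cos (y + h) = 0"
    using ch assms by (metis eq_iff_diff_eq_0 mult_eq_0_iff order_less_irrefl)
  also have "\<dots> \<longleftrightarrow> (\<exists>i. odd i \<and> y + h = of_int i * (pi / 2))" by (rule cos_zero_iff_int)
  also have "\<dots> \<longleftrightarrow> (\<exists>i. odd (int n - i) \<and> phase c n \<phi> = of_int i * (pi / 2))"
  proof -
    have "y + h = of_int i * (pi / 2) \<longleftrightarrow> phase c n \<phi> = of_int (int n - i) * (pi / 2)" for i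
      by (auto simp: phase_def y_def h_def algebra_simps)
    moreover have "int n - (int n - i) = i" for i by simp
    ultimately show ?thesis by metis
  qed
  finally show ?thesis by (simp add: y_def)
qed

text \<open>Any fixed compact neighbourhood of 0 on which the cosine is positive would do.\<close>

abbreviation window :: "real set" where "window \<equiv> {- (pi / 4)..pi / 4}"

lemma cos_window: "\<phi> \<in> window \<Longrightarrow> cos \<phi> > 0"
proof -
  assume "\<phi> \<in> window"
  then have "- (pi / 4) \<le> \<phi>" "\<phi> \<le> pi / 4" by auto
  then show ?thesis by (intro cos_gt_zero_pi) (use pi_gt_zero in linarith)+
qed

lemma eigvals_iff_phase:
  assumes "n \<ge> 1" "\<phi> \<in> window"
  shows "2 * sin \<phi> \<in> eigvals a0 n \<longleftrightarrow>
    (\<exists>c\<in>{a0, - a0}. \<exists>i. odd (int n - i) \<and> phase c n \<phi> = of_int i * (pi / 2))"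
proof -
  have c: "cos \<phi> > 0" using assms by (intro cos_window)
  have co: "cos (pi / 2 - \<phi>) = sin \<phi>" and si: "sin (pi / 2 - \<phi>) = cos \<phi>"
    by (simp_all add: cos_diff sin_diff)
  have "sin (pi / 2 - \<phi>) \<noteq> 0" using c si by simp
  from eigvals_iff_sin[OF assms(1) this, of a0] show ?thesis
    unfolding co sin_equation_iff_phase[OF c] .
qed

lemma phase_shift_DERIV:
  assumes "cos \<phi> \<noteq> 0"
  shows "(phase_shift c has_real_derivative
     inverse (1 + ((c - sin \<phi>) / cos \<phi>)\<^sup>2) *
       ((- cos \<phi> * cos \<phi> + (c - sin \<phi>) * sin \<phi>) / (cos \<phi> * cos \<phi>))) (at \<phi>)"
proof -
  have "((\<lambda>\<phi>. (c - sin \<phi>) / cos \<phi>) has_real_derivative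
      ((0 - cos \<phi>) * cos \<phi> - (c - sin \<phi>) * (- sin \<phi>)) / (cos \<phi> * cos \<phi>)) (at \<phi>)"
    by (intro DERIV_divide DERIV_diff DERIV_const DERIV_sin DERIV_cos assms)
  from DERIV_chain2[OF DERIV_arctan this] show ?thesis
    unfolding phase_shift_def[abs_def] by simp
qed

lemma continuous_on_phase_shift: "continuous_on window (phase_shift c)"
proof -
  have "\<forall>\<phi>\<in>window. cos \<phi> \<noteq> 0" using cos_window by force
  then show ?thesis unfolding phase_shift_def[abs_def] by (intro continuous_intros)
qed

lemma phase_shift_Lipschitz:
  "\<exists>L. \<forall>x\<in>window. \<forall>y\<in>window. x < y \<longrightarrow> phase_shift c y - phase_shift c x \<le> L * (y - x)"
proof -
  let ?d = "\<lambda>\<phi>. inverse (1 + ((c - sin \<phi>) / cos \<phi>)\<^sup>2) *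
       ((- cos \<phi> * cos \<phi> + (c - sin \<phi>) * sin \<phi>) / (cos \<phi> * cos \<phi>))"
  have nz: "\<forall>\<phi>\<in>window. cos \<phi> \<noteq> 0" using cos_window by force
  have nz': "1 + t\<^sup>2 \<noteq> 0" for t :: real by (simp add: add_nonneg_eq_0_iff)
  have "continuous_on window ?d"
    using nz nz' by (intro continuous_intros) auto
  then have "\<exists>m\<in>window. \<forall>\<phi>\<in>window. ?d \<phi> \<le> ?d m"
    by (intro continuous_attains_sup compact_Icc) auto
  then obtain m where m: "\<And>\<phi>. \<phi> \<in> window \<Longrightarrow> ?d \<phi> \<le> ?d m" by blast
  define L where "L = ?d m"
  have L: "?d \<phi> \<le> L" if "\<phi> \<in> window" for \<phi> using m[OF that] by (simp only: L_def)
  have "phase_shift c y - phase_shift c x \<le> L * (y - x)" if "x \<in> window" "y \<in> window" "x < y" for x y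
  proof -
    have "\<exists>z. x < z \<and> z < y \<and> phase_shift c y - phase_shift c x = (y - x) * ?d z"
      by (rule MVT2[OF that(3)], rule phase_shift_DERIV) (use nz that in auto)
    then obtain z where z: "x < z" "z < y" "phase_shift c y - phase_shift c x = (y - x) * ?d z"
      by blast
    have "?d z \<le> L" using L[of z] z that by auto
    then have "(y - x) * ?d z \<le> (y - x) * L" by (rule mult_left_mono) (use that in simp)
    then show ?thesis unfolding z(3) by (simp only: mult.commute)
  qed
  then show ?thesis by blast
qed

text \<open>The slope of the phase is \<open>n\<close> minus a quantity bounded on the window independently of \<open>n\<close>.\<close>

lemma eventually_phase_strict_mono:
  "\<forall>\<^sub>F n in sequentially. strict_mono_on window (phase c n)"
proof -
  obtain L where L: "\<And>x y. x \<in> window \<Longrightarrow> y \<in> window \<Longrightarrow> x < y \<Longrightarrow>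
      phase_shift c y - phase_shift c x \<le> L * (y - x)" using phase_shift_Lipschitz by blast
  have "\<forall>\<^sub>F n in sequentially. L < real n"
    using filterlim_real_sequentially by (simp add: filterlim_at_top_dense)
  then show ?thesis
  proof eventually_elim
    case (elim n)
    show ?case
    proof (rule strict_mono_onI)
      fix x y :: real assume xy: "x \<in> window" "y \<in> window" "x < y"
      have "L * (y - x) < real n * (y - x)" using elim xy by simp
      then show "phase c n x < phase c n y" using L[OF xy] by (simp add: phase_def algebra_simps)
    qed
  qed
qed

lemma phase_shift_bounds: "- (pi / 2) < phase_shift c \<phi>" "phase_shift c \<phi> < pi / 2"
  unfolding phase_shift_def by (rule arctan_lbound arctan_ubound)+

text \<open>This gap, smaller than the spacing \<open>pi\<close> of the admissible phase values, is what makes the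
  solutions for \<open>a0\<close> and for \<open>- a0\<close> interlace.\<close>

lemma phase_gap:
  assumes "a0 > 0" "cos \<phi> > 0"
  shows "phase a0 n \<phi> < phase (- a0) n \<phi>" "phase (- a0) n \<phi> < phase a0 n \<phi> + pi"
proof -
  have "phase_shift (- a0) \<phi> < phase_shift a0 \<phi>"
    using assms by (simp add: phase_shift_def arctan_less_iff divide_strict_right_mono)
  then show "phase a0 n \<phi> < phase (- a0) n \<phi>" by (simp add: phase_def)
  show "phase (- a0) n \<phi> < phase a0 n \<phi> + pi"
    using phase_shift_bounds(1)[of "- a0" \<phi>] phase_shift_bounds(2)[of a0 \<phi>] by (simp add: phase_def)
qed

definition phase_root :: "real \<Rightarrow> nat \<Rightarrow> real \<Rightarrow> real" where
  "phase_root c n t = (SOME \<phi>. \<phi> \<in> window \<and> phase c n \<phi> = t)"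

text \<open>The phase differs from \<open>n \<phi>\<close> by less than \<open>pi / 2\<close>, so at the ends of the window it is
  beyond any given value once \<open>n\<close> is large.\<close>

lemma eventually_phase_root:
  "\<forall>\<^sub>F n in sequentially. phase_root c n t \<in> window \<and> phase c n (phase_root c n t) = t"
proof -
  have "\<forall>\<^sub>F n in sequentially. (\<bar>t\<bar> + pi / 2) / (pi / 4) < real n"
    using filterlim_real_sequentially by (simp add: filterlim_at_top_dense)
  then show ?thesis
  proof eventually_elim
    case (elim n)
    then have n: "\<bar>t\<bar> + pi / 2 < real n * (pi / 4)" by (simp add: field_simps)
    have "\<exists>\<phi>. - (pi / 4) \<le> \<phi> \<and> \<phi> \<le> pi / 4 \<and> phase c n \<phi> = t"
    proof (rule IVT')
      show "phase c n (- (pi / 4)) \<le> t"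
        using n phase_shift_bounds(1)[of c "- (pi / 4)"] by (simp add: phase_def)
      show "t \<le> phase c n (pi / 4)"
        using n phase_shift_bounds(2)[of c "pi / 4"] by (simp add: phase_def)
      show "continuous_on window (phase c n)"
        unfolding phase_def by (intro continuous_intros continuous_on_phase_shift)
    qed auto
    then have "\<exists>\<phi>. \<phi> \<in> window \<and> phase c n \<phi> = t" by auto
    then show ?case unfolding phase_root_def by (rule someI_ex)
  qed
qed

text \<open>Since the arctangent is bounded, \<open>n \<phi>\<close> is bounded, so \<open>\<phi>\<close> tends to 0 and the arctangent
  to its value \<open>arctan c\<close> at 0; finally \<open>sin \<phi>\<close> is asymptotic to \<open>\<phi>\<close>.\<close>

lemma phase_root_limit:
  "(\<lambda>n. real n * (2 * sin (phase_root c n t))) \<longlonglongrightarrow> 2 * (t + arctan c)"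
proof -
  define r where "r n = phase_root c n t" for n
  have ev: "\<forall>\<^sub>F n in sequentially. real n * r n = t + phase_shift c (r n)"
    using eventually_phase_root[of c t] by eventually_elim (auto simp: r_def phase_def)
  have r0: "r \<longlonglongrightarrow> 0"
  proof (rule tendsto_0_le[where K = 1])
    show "\<forall>\<^sub>F n in sequentially. norm (r n) \<le> norm ((\<bar>t\<bar> + pi / 2) / real n) * 1"
      using ev eventually_gt_at_top[of 0]
    proof eventually_elim
      case (elim n)
      have "real n * \<bar>r n\<bar> = \<bar>real n * r n\<bar>" by (simp add: abs_mult)
      also have "\<dots> \<le> \<bar>t\<bar> + pi / 2" using elim(1) phase_shift_bounds[of c "r n"] by linarith
      finally show ?case using elim(2) by (simp add: field_simps)
    qed
    show "(\<lambda>n. (\<bar>t\<bar> + pi / 2) / real n) \<longlonglongrightarrow> 0" by (rule lim_const_over_n)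
  qed
  have "isCont (phase_shift c) 0" by (rule DERIV_isCont[OF phase_shift_DERIV]) simp
  then have "(\<lambda>n. phase_shift c (r n)) \<longlonglongrightarrow> phase_shift c 0"
    using r0 by (rule isCont_tendsto_compose)
  then have "(\<lambda>n. t + phase_shift c (r n)) \<longlonglongrightarrow> t + arctan c"
    by (intro tendsto_intros) (simp add: phase_shift_def)
  then have nr: "(\<lambda>n. real n * r n) \<longlonglongrightarrow> t + arctan c"
    by (rule Lim_transform_eventually) (use ev in eventually_elim, simp)
  \<comment> \<open>\<open>sinc\<close> is \<open>sin y / y\<close> extended continuously by 1; the extension matters because
     the root may be exactly 0.\<close>
  define sinc where "sinc y = (if y = 0 then 1 else sin y / y)" for y :: real
  have "(sinc \<longlongrightarrow> 1) (at 0)"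
  proof (rule Lim_transform_eventually)
    show "((\<lambda>y. sin y / y) \<longlongrightarrow> 1) (at (0::real))"
      using DERIV_sin[of "0::real"] by (simp add: DERIV_def)
  qed (auto simp: sinc_def eventually_at_filter)
  then have "isCont sinc 0" by (simp add: isCont_def sinc_def)
  then have "(\<lambda>n. sinc (r n)) \<longlonglongrightarrow> sinc 0" using r0 by (rule isCont_tendsto_compose)
  then have lim: "(\<lambda>n. 2 * (real n * r n) * sinc (r n)) \<longlonglongrightarrow> 2 * (t + arctan c) * 1"
    by (intro tendsto_intros nr) (simp add: sinc_def)
  have eq: "2 * (real n * r n) * sinc (r n) = real n * (2 * sin (r n))" for n
    by (simp add: sinc_def)
  show ?thesis using lim unfolding eq unfolding r_def mult_1_right .
qed

section \<open>The eigenvalues near 0 in order\<close>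

text \<open>The solution that turns out to carry the label \<open>j\<close>. Admissible phase values \<open>i pi / 2\<close> have
  \<open>n - i\<close> odd, hence \<open>i = j\<close> in one case and \<open>i = j - 1\<close> in the other; the two families take turns.\<close>

definition angle :: "real \<Rightarrow> nat \<Rightarrow> int \<Rightarrow> real" where
  "angle a0 n j = (if odd (int n - j) then phase_root (- a0) n (of_int j * (pi / 2))
     else phase_root a0 n (of_int (j - 1) * (pi / 2)))"

lemma eventually_angle:
  "\<forall>\<^sub>F n in sequentially. angle a0 n j \<in> window \<and>
     phase (if odd (int n - j) then - a0 else a0) n (angle a0 n j)
       = of_int (if odd (int n - j) then j else j - 1) * (pi / 2)"
  using eventually_phase_root[of "- a0" "of_int j * (pi / 2)"]
    eventually_phase_root[of a0 "of_int (j - 1) * (pi / 2)"]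
  by eventually_elim (simp add: angle_def)

text \<open>Admissible phase values are \<open>pi\<close> apart.\<close>

lemma no_lattice_point_between:
  fixes i k :: int
  assumes "even (i - k)" "of_int k * (pi / 2) < of_int i * (pi / 2)"
    "of_int i * (pi / 2) < of_int k * (pi / 2) + pi"
  shows False
proof -
  have "(of_int k :: real) < of_int i" using assms(2) by simp
  moreover have "of_int i * (pi / 2) < (of_int k + 2) * (pi / 2)"
    using assms(3) by (simp add: algebra_simps)
  then have "(of_int i :: real) < of_int k + 2" by (subst (asm) mult_less_cancel_right_pos) auto
  ultimately have "k < i" "i < k + 2" by linarith+
  then have "i = k + 1" by simp
  then show False using assms(1) by simp
qed

text \<open>Here \<open>x\<close> and \<open>y\<close> are the angles for \<open>j\<close> and \<open>j + 1\<close>. Between them, by monotonicity and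
  \<open>phase_gap\<close>, each of the two phases stays inside an open interval of length \<open>pi\<close> whose end
  points are admissible values, so it cannot take an admissible value.\<close>

lemma angle_neighbours:
  fixes n :: nat and j :: int
  defines "\<epsilon> \<equiv> odd (int n - j)"
  assumes a0: "a0 > 0" and n: "n \<ge> 1"
    and mono: "strict_mono_on window (phase a0 n)" "strict_mono_on window (phase (- a0) n)"
    and x: "x \<in> window" "phase (if \<epsilon> then - a0 else a0) n x = of_int (if \<epsilon> then j else j - 1) * (pi / 2)"
    and y: "y \<in> window" "phase (if \<epsilon> then a0 else - a0) n y = of_int (if \<epsilon> then j else j + 1) * (pi / 2)"
  shows "x < y" and "\<And>z. x < z \<Longrightarrow> z < y \<Longrightarrow> 2 * sin z \<notin> eigvals a0 n"
proof -
  define k where "k = (if \<epsilon> then j else j - 1)"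
  have par: "odd (int n - k)" by (auto simp: k_def \<epsilon>_def)
  note gap = phase_gap[OF a0 cos_window]
  have less: "phase c n u < phase c n v \<longleftrightarrow> u < v" if "c \<in> {a0, - a0}" "u \<in> window" "v \<in> window" for c u v
    using mono that by (auto simp: strict_mono_on_less)
  have y': "\<not> \<epsilon> \<Longrightarrow> phase (- a0) n y = of_int k * (pi / 2) + pi"
    using y(2) by (simp add: k_def field_simps)
  show "x < y"
  proof (cases \<epsilon>)
    case True
    then have "phase (- a0) n x < phase (- a0) n y" using x y gap(1)[OF y(1), of n] by simp
    then show ?thesis using less x y by simp
  next
    case False
    then have "phase (- a0) n x < phase (- a0) n y" using x y' gap(2)[OF x(1), of n] by (simp add: k_def)
    then show ?thesis using less x y by simp
  qed
  fix z assume z: "x < z" "z < y"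
  then have zw: "z \<in> window" using x(1) y(1) by auto
  show "2 * sin z \<notin> eigvals a0 n"
  proof
    assume "2 * sin z \<in> eigvals a0 n"
    then obtain c i where c: "c \<in> {a0, - a0}" and i: "odd (int n - i)" "phase c n z = of_int i * (pi / 2)"
      unfolding eigvals_iff_phase[OF n zw] by blast
    have p: "phase c n x < phase c n z" "phase c n z < phase c n y" if "c \<in> {a0, - a0}" for c
      using less[OF that] x y z zw by auto
    note q = p[of a0, simplified] p[of "- a0", simplified] gap[OF zw, of n]
    have ev: "even (i - k)" "even (i - (k - 2))" using i(1) par by presburger+
    \<comment> \<open>For \<open>\<epsilon>\<close> the phases for \<open>- a0\<close> and \<open>a0\<close> lie on different sides of \<open>k pi / 2\<close>; otherwise both lie
      in the interval of length \<open>pi\<close> above it.\<close>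
    show False
    proof (cases \<epsilon>)
      case True
      then have b: "phase (- a0) n x = of_int k * (pi / 2)" "phase a0 n y = of_int k * (pi / 2)"
        using x y by (auto simp: k_def)
      have sh: "of_int (k - 2) * (pi / 2) + pi = of_int k * (pi / 2)" by (simp add: algebra_simps)
      consider "c = - a0" | "c = a0" using c by blast
      then show False
      proof cases
        case 1
        then have "of_int k * (pi / 2) < phase c n z" "phase c n z < of_int k * (pi / 2) + pi"
          using q b by auto
        then show False using no_lattice_point_between[OF ev(1)] i(2) by simp
      next
        case 2
        then have "of_int (k - 2) * (pi / 2) < phase c n z"
          "phase c n z < of_int (k - 2) * (pi / 2) + pi"
          unfolding sh 2 using q b sh by linarith+
        then show False using no_lattice_point_between[OF ev(2)] i(2) by simp
      qed
    next
      case False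
      then have b: "phase a0 n x = of_int k * (pi / 2)" using x by (auto simp: k_def)
      have "of_int k * (pi / 2) < phase c n z" "phase c n z < of_int k * (pi / 2) + pi"
        using c q b y'[OF False] by auto
      then show False using no_lattice_point_between[OF ev(1)] i(2) by simp
    qed
  qed
qed

lemma sin_window_less:
  assumes "x \<in> window" "y \<in> window"
  shows "sin x < sin y \<longleftrightarrow> x < y"
  using assms by (intro sin_mono_less_eq) (auto intro: order_trans[rotated])

lemma eventually_eigenvalue_neighbours:
  assumes a0: "a0 > 0"
  shows "\<forall>\<^sub>F n in sequentially. 2 * sin (angle a0 n j) \<in> eigvals a0 n
    \<and> 2 * sin (angle a0 n j) < 2 * sin (angle a0 n (j + 1))
    \<and> (\<forall>x\<in>eigvals a0 n. \<not> (2 * sin (angle a0 n j) < x \<and> x < 2 * sin (angle a0 n (j + 1))))"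
  using eventually_angle[of a0 j] eventually_angle[of a0 "j + 1"] eventually_ge_at_top[of 1]
    eventually_phase_strict_mono[of a0] eventually_phase_strict_mono[of "- a0"]
proof eventually_elim
  case (elim n)
  let ?x = "angle a0 n j" and ?y = "angle a0 n (j + 1)"
  have par: "odd (int n - (j + 1)) \<longleftrightarrow> \<not> odd (int n - j)" by presburger
  have w: "?x \<in> window" "?y \<in> window" using elim by auto
  have px: "phase (if odd (int n - j) then - a0 else a0) n ?x = of_int (if odd (int n - j) then j else j - 1) * (pi / 2)"
    using elim by blast
  have py: "phase (if odd (int n - j) then a0 else - a0) n ?y = of_int (if odd (int n - j) then j else j + 1) * (pi / 2)"
    using elim(2) unfolding par by (auto split: if_splits)
  note nb = angle_neighbours[OF a0 elim(3) elim(4,5) w(1) px w(2) py]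
  have mem: "2 * sin ?x \<in> eigvals a0 n"
    unfolding eigvals_iff_phase[OF elim(3) w(1)]
  proof (cases "odd (int n - j)")
    case True
    have "phase (- a0) n ?x = of_int j * (pi / 2)" using px unfolding if_P[OF True] .
    with True show "\<exists>c\<in>{a0, - a0}. \<exists>i. odd (int n - i) \<and> phase c n ?x = of_int i * (pi / 2)"
      by blast
  next
    case False
    have "phase a0 n ?x = of_int (j - 1) * (pi / 2)" using px unfolding if_not_P[OF False] .
    moreover have "odd (int n - (j - 1))" using False by presburger
    ultimately show "\<exists>c\<in>{a0, - a0}. \<exists>i. odd (int n - i) \<and> phase c n ?x = of_int i * (pi / 2)"
      by blast
  qed
  have none: False if x: "x \<in> eigvals a0 n" "2 * sin ?x < x" "x < 2 * sin ?y" for x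
  proof -
    define z where "z = arcsin (x / 2)"
    have "-1 \<le> x / 2" "x / 2 \<le> 1"
      using x(2,3) sin_ge_minus_one[of ?x] sin_le_one[of ?y] by linarith+
    then have z: "sin z = x / 2" "- (pi / 2) \<le> z" "z \<le> pi / 2"
      unfolding z_def by (simp_all only: sin_arcsin arcsin_lbound arcsin_ubound)
    have "sin ?x < sin z" "sin z < sin ?y" using x z by auto
    then have "?x < z" "z < ?y"
      using w z by (auto simp: sin_mono_less_eq)
    then show False using nb(2)[of z] x(1) z(1) by simp
  qed
  show ?case using mem nb(1) sin_window_less[OF w] none by auto
qed

lemma angle_limit_odd:
  assumes "F \<le> sequentially" "\<forall>\<^sub>F n in F. odd (int n - j)"
  shows "((\<lambda>n. real n * (2 * sin (angle a0 n j))) \<longlongrightarrow> of_int j * pi - 2 * arctan a0) F"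
proof -
  have "((\<lambda>n. real n * (2 * sin (phase_root (- a0) n (of_int j * (pi / 2)))))
      \<longlongrightarrow> 2 * (of_int j * (pi / 2) + arctan (- a0))) F"
    by (rule tendsto_mono[OF assms(1) phase_root_limit])
  then have "((\<lambda>n. real n * (2 * sin (angle a0 n j)))
      \<longlongrightarrow> 2 * (of_int j * (pi / 2) + arctan (- a0))) F"
    by (rule Lim_transform_eventually)
      (use assms(2) in eventually_elim, simp add: angle_def)
  then show ?thesis by (simp add: arctan_minus algebra_simps)
qed

lemma angle_limit_even:
  assumes "F \<le> sequentially" "\<forall>\<^sub>F n in F. even (int n - j)"
  shows "((\<lambda>n. real n * (2 * sin (angle a0 n j))) \<longlongrightarrow> of_int (j - 1) * pi + 2 * arctan a0) F"
proof -
  have "((\<lambda>n. real n * (2 * sin (phase_root a0 n (of_int (j - 1) * (pi / 2)))))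
      \<longlongrightarrow> 2 * (of_int (j - 1) * (pi / 2) + arctan a0)) F"
    by (rule tendsto_mono[OF assms(1) phase_root_limit])
  then have "((\<lambda>n. real n * (2 * sin (angle a0 n j)))
      \<longlongrightarrow> 2 * (of_int (j - 1) * (pi / 2) + arctan a0)) F"
    by (rule Lim_transform_eventually)
      (use assms(2) in eventually_elim, simp add: angle_def)
  moreover have "2 * (of_int (j - 1) * (pi / 2) + arctan a0) = of_int (j - 1) * pi + 2 * arctan a0"
    by (simp add: field_simps)
  ultimately show ?thesis by (simp only:)
qed

abbreviation (input) parity_filter :: "(nat \<Rightarrow> bool) \<Rightarrow> nat filter" where
  "parity_filter P \<equiv> inf sequentially (principal {n. P n})"

text \<open>The four limits of \<open>n\<close> times these values are \<open>- 2 A\<close> and \<open>2 A - pi\<close> for the label 0, and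
  \<open>2 A\<close> and \<open>pi - 2 A\<close> for the label 1, with \<open>A = arctan a0\<close> strictly between 0 and \<open>pi / 2\<close>.\<close>

lemma eventually_angle_sign:
  assumes a0: "a0 > 0"
  shows "\<forall>\<^sub>F n in sequentially. 2 * sin (angle a0 n 0) < 0"
    and "\<forall>\<^sub>F n in sequentially. 0 \<le> 2 * sin (angle a0 n 1)"
proof -
  have A: "0 < arctan a0" "arctan a0 < pi / 2" using a0 arctan_ubound[of a0] by simp_all
  have join: "\<forall>\<^sub>F n in sequentially. Q n"
    if "\<forall>\<^sub>F n in parity_filter odd. Q n" "\<forall>\<^sub>F n in parity_filter even. Q n" for Q
    using that unfolding eventually_inf_principal by eventually_elim auto
  have le: "parity_filter P \<le> sequentially" for P by simp
  have par: "\<forall>\<^sub>F n in parity_filter P. P n" for P by (simp add: eventually_inf_principal)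
  have neg: "\<forall>\<^sub>F n in F. 2 * sin (f n) < 0"
    if "((\<lambda>n. real n * (2 * sin (f n))) \<longlongrightarrow> l) F" "l < 0" for f l F
    using order_tendstoD(2)[OF that] by eventually_elim (auto simp: mult_less_0_iff)
  have pos: "\<forall>\<^sub>F n in F. 0 \<le> 2 * sin (f n)"
    if "((\<lambda>n. real n * (2 * sin (f n))) \<longlongrightarrow> l) F" "0 < l" for f l F
    using order_tendstoD(1)[OF that] by eventually_elim (auto simp: zero_less_mult_iff)
  show "\<forall>\<^sub>F n in sequentially. 2 * sin (angle a0 n 0) < 0"
  proof (rule join)
    show "\<forall>\<^sub>F n in parity_filter odd. 2 * sin (angle a0 n 0) < 0"
      by (rule neg[OF angle_limit_odd[OF le]]) (use par[of odd] A in auto)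
    show "\<forall>\<^sub>F n in parity_filter even. 2 * sin (angle a0 n 0) < 0"
      by (rule neg[OF angle_limit_even[OF le]]) (use par[of even] A in auto)
  qed
  show "\<forall>\<^sub>F n in sequentially. 0 \<le> 2 * sin (angle a0 n 1)"
  proof (rule join)
    show "\<forall>\<^sub>F n in parity_filter odd. 0 \<le> 2 * sin (angle a0 n 1)"
      by (rule pos[OF angle_limit_even[OF le]]) (use par[of odd] A in auto)
    show "\<forall>\<^sub>F n in parity_filter even. 0 \<le> 2 * sin (angle a0 n 1)"
      by (rule pos[OF angle_limit_odd[OF le]]) (use par[of even] A in auto)
  qed
qed

lemma eventually_\<xi>_eq:
  assumes a0: "a0 > 0"
  shows "\<forall>\<^sub>F n in sequentially. j \<in> label_range (eigvals a0 n) \<and> \<xi> a0 n j = 2 * sin (angle a0 n j)"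
  unfolding \<xi>_def
proof (rule eventually_label_eq[where e = "\<lambda>n j. 2 * sin (angle a0 n j)"
      and E = "\<lambda>n. eigvals a0 n", OF finite_eigvals])
  note nb = eventually_eigenvalue_neighbours[OF a0]
  show "\<forall>\<^sub>F n in sequentially. 2 * sin (angle a0 n j) \<in> eigvals a0 n" for j
    using nb[of j] by eventually_elim blast
  show "\<forall>\<^sub>F n in sequentially. 2 * sin (angle a0 n j) < 2 * sin (angle a0 n (j + 1))" for j
    using nb[of j] by eventually_elim blast
  show "\<forall>\<^sub>F n in sequentially. \<forall>x\<in>eigvals a0 n.
      \<not> (2 * sin (angle a0 n j) < x \<and> x < 2 * sin (angle a0 n (j + 1)))" for j
    using nb[of j] by eventually_elim blast
  show "\<forall>\<^sub>F n in sequentially. 2 * sin (angle a0 n 0) < 0"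
    by (rule eventually_angle_sign(1)[OF a0])
  show "\<forall>\<^sub>F n in sequentially. 0 \<le> 2 * sin (angle a0 n 1)"
    by (rule eventually_angle_sign(2)[OF a0])
qed

lemma spacing_limit:
  assumes a0: "a0 > 0" and F: "F \<le> sequentially"
    and l: "((\<lambda>n. real n * (2 * sin (angle a0 n (j + 1)))) \<longlongrightarrow> l') F"
      "((\<lambda>n. real n * (2 * sin (angle a0 n j))) \<longlongrightarrow> l) F"
  shows "((\<lambda>n. real n * (\<xi> a0 n (j + 1) - \<xi> a0 n j)) \<longlongrightarrow> l' - l) F"
proof (rule Lim_transform_eventually[OF tendsto_diff[OF l]])
  have "\<forall>\<^sub>F n in sequentially. real n * (2 * sin (angle a0 n (j + 1))) - real n * (2 * sin (angle a0 n j))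
      = real n * (\<xi> a0 n (j + 1) - \<xi> a0 n j)"
    using eventually_\<xi>_eq[OF a0, of j] eventually_\<xi>_eq[OF a0, of "j + 1"]
    by eventually_elim (simp add: right_diff_distrib)
  then show "\<forall>\<^sub>F n in F. real n * (2 * sin (angle a0 n (j + 1))) - real n * (2 * sin (angle a0 n j))
      = real n * (\<xi> a0 n (j + 1) - \<xi> a0 n j)"
    using F by (rule filter_leD[rotated])
qed

lemma spacing_limit_odd:
  assumes "a0 > 0"
  shows "((\<lambda>n. real n * (\<xi> a0 n (j + 1) - \<xi> a0 n j)) \<longlongrightarrow> 4 * arctan a0)
    (parity_filter (\<lambda>n. odd (int n - j)))" (is "(_ \<longlongrightarrow> _) ?F")
proof -
  have F: "?F \<le> sequentially" by simp
  have o: "\<forall>\<^sub>F n in ?F. odd (int n - j)" by (simp add: eventually_inf_principal)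
  then have e: "\<forall>\<^sub>F n in ?F. even (int n - (j + 1))" by eventually_elim presburger
  show ?thesis
    using spacing_limit[OF assms F angle_limit_even[OF F e] angle_limit_odd[OF F o]]
    by (simp add: algebra_simps)
qed

lemma spacing_limit_even:
  assumes "a0 > 0"
  shows "((\<lambda>n. real n * (\<xi> a0 n (j + 1) - \<xi> a0 n j)) \<longlongrightarrow> 2 * pi - 4 * arctan a0)
    (parity_filter (\<lambda>n. even (int n - j)))" (is "(_ \<longlongrightarrow> _) ?F")
proof -
  have F: "?F \<le> sequentially" by simp
  have e: "\<forall>\<^sub>F n in ?F. even (int n - j)" by (simp add: eventually_inf_principal)
  then have o: "\<forall>\<^sub>F n in ?F. odd (int n - (j + 1))" by eventually_elim presburger
  show ?thesis
    using spacing_limit[OF assms F angle_limit_odd[OF F o] angle_limit_even[OF F e]]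
    by (simp add: algebra_simps)
qed

text \<open>Along odd \<open>n\<close> the numerator and the denominator have the two different limiting spacings.\<close>

lemma no_clock_spacing:
  assumes a0: "a0 > 0" "a0 \<noteq> 1"
  shows "\<not> (\<lambda>n. (\<xi> a0 n 2 - \<xi> a0 n 1) / (\<xi> a0 n 1 - \<xi> a0 n 0)) \<longlonglongrightarrow> 1"
proof
  assume lim: "(\<lambda>n. (\<xi> a0 n 2 - \<xi> a0 n 1) / (\<xi> a0 n 1 - \<xi> a0 n 0)) \<longlonglongrightarrow> 1"
  let ?F = "parity_filter odd"
  have A: "0 < arctan a0" using a0 by simp
  have s: "((\<lambda>n. real n * (\<xi> a0 n 1 - \<xi> a0 n 0)) \<longlongrightarrow> 4 * arctan a0) ?F"
    using spacing_limit_odd[OF a0(1), of 0] by simp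
  have t: "((\<lambda>n. real n * (\<xi> a0 n 2 - \<xi> a0 n 1)) \<longlongrightarrow> 2 * pi - 4 * arctan a0) ?F"
    using spacing_limit_even[OF a0(1), of 1] by simp
  have "((\<lambda>n. (real n * (\<xi> a0 n 2 - \<xi> a0 n 1)) / (real n * (\<xi> a0 n 1 - \<xi> a0 n 0)))
      \<longlongrightarrow> (2 * pi - 4 * arctan a0) / (4 * arctan a0)) ?F"
    by (rule tendsto_divide[OF t s]) (use A in simp)
  then have l1: "((\<lambda>n. (\<xi> a0 n 2 - \<xi> a0 n 1) / (\<xi> a0 n 1 - \<xi> a0 n 0))
      \<longlongrightarrow> (2 * pi - 4 * arctan a0) / (4 * arctan a0)) ?F"
    by (rule Lim_transform_eventually) (auto simp: eventually_inf_principal)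
  have l2: "((\<lambda>n. (\<xi> a0 n 2 - \<xi> a0 n 1) / (\<xi> a0 n 1 - \<xi> a0 n 0)) \<longlongrightarrow> 1) ?F"
    by (rule tendsto_mono[OF _ lim]) simp
  have "?F \<noteq> bot"
  proof
    assume "?F = bot"
    then have "\<forall>\<^sub>F n::nat in sequentially. even n"
      by (simp add: trivial_limit_def eventually_inf_principal)
    then obtain N where "\<And>n::nat. n \<ge> N \<Longrightarrow> even n" by (auto simp: eventually_sequentially)
    from this[of "2 * N + 1"] show False by simp
  qed
  then have "(2 * pi - 4 * arctan a0) / (4 * arctan a0) = 1" using l1 l2 by (rule tendsto_unique)
  then have "arctan a0 = arctan 1" using A by (simp add: field_simps arctan_one)
  then show False using a0(2) by (simp add: arctan_eq_iff)
qed

theorem mainTheorem3: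
  fixes a0 :: real
  assumes "a0 > 0"
  shows "(\<forall>j. \<forall>\<^sub>F n in sequentially.
            j \<in> label_range (eigvals a0 n) \<and> j + 1 \<in> label_range (eigvals a0 n))
    \<and> (\<forall>j. ((\<lambda>n. real n * (\<xi> a0 n (j + 1) - \<xi> a0 n j)) \<longlongrightarrow> 4 * arctan a0)
            (inf sequentially (principal {n. odd (int n - j)})))
    \<and> (\<forall>j. ((\<lambda>n. real n * (\<xi> a0 n (j + 1) - \<xi> a0 n j)) \<longlongrightarrow> 2 * pi - 4 * arctan a0)
            (inf sequentially (principal {n. even (int n - j)})))
    \<and> (a0 \<noteq> 1 \<longrightarrow>
         \<not> (\<forall>j. (\<lambda>n. (\<xi> a0 n (j + 1) - \<xi> a0 n j) / (\<xi> a0 n 1 - \<xi> a0 n 0)) \<longlonglongrightarrow> 1))"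
proof (intro conjI allI impI)
  fix j
  show "\<forall>\<^sub>F n in sequentially. j \<in> label_range (eigvals a0 n) \<and> j + 1 \<in> label_range (eigvals a0 n)"
    using eventually_\<xi>_eq[OF assms, of j] eventually_\<xi>_eq[OF assms, of "j + 1"]
    by eventually_elim simp
  show "((\<lambda>n. real n * (\<xi> a0 n (j + 1) - \<xi> a0 n j)) \<longlongrightarrow> 4 * arctan a0)
      (inf sequentially (principal {n. odd (int n - j)}))"
    by (rule spacing_limit_odd[OF assms])
  show "((\<lambda>n. real n * (\<xi> a0 n (j + 1) - \<xi> a0 n j)) \<longlongrightarrow> 2 * pi - 4 * arctan a0)
      (inf sequentially (principal {n. even (int n - j)}))"
    by (rule spacing_limit_even[OF assms])
next
  assume "a0 \<noteq> 1"
  then have *: "\<not> (\<lambda>n. (\<xi> a0 n 2 - \<xi> a0 n 1) / (\<xi> a0 n 1 - \<xi> a0 n 0)) \<longlonglongrightarrow> 1"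
    by (rule no_clock_spacing[OF assms])
  show "\<not> (\<forall>j. (\<lambda>n. (\<xi> a0 n (j + 1) - \<xi> a0 n j) / (\<xi> a0 n 1 - \<xi> a0 n 0)) \<longlonglongrightarrow> 1)"
  proof
    assume "\<forall>j. (\<lambda>n. (\<xi> a0 n (j + 1) - \<xi> a0 n j) / (\<xi> a0 n 1 - \<xi> a0 n 0)) \<longlonglongrightarrow> 1"
    from this[rule_format, of 1] show False using * by simp
  qed
qed

end
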